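(* Let $n\geq 1$. For any self-adjoint operator $Z\in B(\ell^2_n)$, any unitary operator $U\in B(\ell^2_n)$ and any $f\in C^2(\mathbb{T})$, we have $$ f(e^{iZ}U)-f(U)-\frac{d}{dt}\bigl(f(e^{itZ}U)\bigr)_{\vert t=0} = T_{f^{[2]}}^{e^{iZ}U,U,U}\bigl(e^{iZ}U-U,\,iZU\bigr)+T_{f^{[1]}}^{e^{iZ}U,U}\bigl(e^{iZ}U-U-iZU\bigr). $$
   Context: $\mathbb{T}$ is the unit circle in $\mathbb{C}$; $\ell^2_n$ is $\mathbb{C}^n$ with its standard Hilbert structure. For a function $f$ on $\mathbb{T}$, $\frac{d}{dz}$ denotes the derivative along $\mathbb{T}$, i.e. $\frac{d}{dz}f(z)_{\vert z=z_0}=\lim_{z\to z_0,\,z\in\mathbb{T}\setminus\{z_0\}}\frac{f(z)-f(z_0)}{z-z_0}$. $f(V)$ for a unitary $V$ is defined by functional calculus. Divided differences: for $f\in C^1(\mathbb{T})$, $f^{[1]}\colon\mathbb{T}^2\to\mathbb{C}$ is $f^{[1]}(z_0,z_1)=\frac{f(z_0)-f(z_1)}{z_0-z_1}$ if $z_0\neq z_1$, and $f^{[1]}(z_0,z_0)=\frac{d}{dz}f(z)_{\vert z=z_0}$. For $f\in C^2(\mathbb{T})$, $f^{[2]}\colon\mathbb{T}^3\to\mathbb{C}$ is $f^{[2]}(z_0,z_1,z_2)=\frac{f^{[1]}(z_0,z_1)-f^{[1]}(z_1,z_2)}{z_0-z_2}$ if $z_0\neq z_2$, and $f^{[2]}(z_0,z_1,z_0)=\frac{d}{dz}f^{[1]}(z,z_1)_{\vert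 z=z_0}$. Operator integrals: let $U_0,U_1,U_2\in B(\ell^2_n)$ be unitaries with spectral decompositions $U_j=\sum_{i=1}^n z_i^{(j)}P_i^{(j)}$, where $P_1^{(j)},\dots,P_n^{(j)}$ are the rank one orthogonal projections onto the vectors of an orthonormal basis of eigenvectors of $U_j$, with eigenvalues $z_1^{(j)},\dots,z_n^{(j)}$. For $\phi\colon\mathbb{T}^2\to\mathbb{C}$ and $\psi\colon\mathbb{T}^3\to\mathbb{C}$ set, for $X,Y\in B(\ell^2_n)$, $$T_\phi^{U_0,U_1}(X)=\sum_{i,k=1}^n\phi(z_i^{(0)},z_k^{(1)})P_i^{(0)}XP_k^{(1)},$$ $$T_\psi^{U_0,U_1,U_2}(X,Y)=\sum_{i,j,k=1}^n\psi(z_i^{(0)},z_k^{(1)},z_j^{(2)})P_i^{(0)}XP_k^{(1)}YP_j^{(2)}.$$ *)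

theory Defs
  imports "HOL-Analysis.Analysis"
begin

text \<open>
  Operators on the \<open>n\<close>-dimensional complex Hilbert space are \<open>n \<times> n\<close> matrices
  \<open>complex ^ 'n ^ 'n\<close> with \<open>n = CARD('n)\<close>, composed by \<open>(**)\<close>. The operations \<open>(*)\<close> and \<open>(^)\<close>
  on this type are componentwise and are not used.
\<close>

section \<open>Matrices as operators\<close>

definition cadjoint :: "complex ^ 'n ^ 'n \<Rightarrow> complex ^ 'n ^ 'n"
  where "cadjoint A = (\<chi> i j. cnj (A $ j $ i))"

definition self_adjoint_mat :: "complex ^ 'n ^ 'n \<Rightarrow> bool"
  where "self_adjoint_mat A \<longleftrightarrow> cadjoint A = A"

definition unitary_mat :: "complex ^ 'n ^ 'n \<Rightarrow> bool"
  where "unitary_mat U \<longleftrightarrow> cadjoint U ** U = mat 1 \<and> U ** cadjoint U = mat 1"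

definition cscale :: "complex \<Rightarrow> complex ^ 'n ^ 'n \<Rightarrow> complex ^ 'n ^ 'n"  (infixr \<open>*\<^sub>C\<close> 75)
  where "c *\<^sub>C A = (\<chi> i j. c * A $ i $ j)"

definition mat_power :: "complex ^ 'n ^ 'n \<Rightarrow> nat \<Rightarrow> complex ^ 'n ^ 'n"
  where "mat_power A k = (((**) A) ^^ k) (mat 1)"

definition mat_exp :: "complex ^ 'n ^ 'n \<Rightarrow> complex ^ 'n ^ 'n"
  where "mat_exp A = (\<Sum>k. (1 / fact k) *\<^sub>R mat_power A k)"

text \<open>The library inner product on \<open>complex ^ 'n\<close> is the real one, so the sesquilinear one is
  introduced here (linear in the first argument).\<close>

definition cinner :: "complex ^ 'n \<Rightarrow> complex ^ 'n \<Rightarrow> complex"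
  where "cinner x y = (\<Sum>i\<in>UNIV. x $ i * cnj (y $ i))"

text \<open>For a unit vector \<open>v\<close>, the orthogonal projection \<open>x \<mapsto> cinner x v *s v\<close> onto the line
  spanned by \<open>v\<close>.\<close>

definition rank_one_proj :: "complex ^ 'n \<Rightarrow> complex ^ 'n ^ 'n"
  where "rank_one_proj v = (\<chi> i j. v $ i * cnj (v $ j))"

text \<open>The index type \<open>'n\<close> has as many elements as the dimension, so an orthonormal family
  \<open>b :: 'n \<Rightarrow> complex ^ 'n\<close> is an orthonormal basis.\<close>

definition orthonormal_basis :: "('n \<Rightarrow> complex ^ 'n) \<Rightarrow> bool"
  where "orthonormal_basis b \<longleftrightarrow> (\<forall>i j. cinner (b i) (b j) = (if i = j then 1 else 0))"

definition eigenbasis ::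
    "complex ^ 'n ^ 'n \<Rightarrow> ('n \<Rightarrow> complex ^ 'n) \<Rightarrow> ('n \<Rightarrow> complex) \<Rightarrow> bool"
  where "eigenbasis U b z \<longleftrightarrow> orthonormal_basis b \<and> (\<forall>i. U *v b i = z i *s b i)"

section \<open>Functional calculus and operator integrals\<close>

text \<open>The sums below do not depend on the chosen orthonormal eigenbases, which exist when the
  operators are unitary; the definite descriptions denote their common values. Outside that setting
  (if there is no eigenbasis) the values are unspecified.\<close>

definition fun_calc :: "(complex \<Rightarrow> complex) \<Rightarrow> complex ^ 'n ^ 'n \<Rightarrow> complex ^ 'n ^ 'n"
  where "fun_calc f U = (THE R. \<exists>b z. eigenbasis U b z \<and>
    R = (\<Sum>i\<in>UNIV. f (z i) *\<^sub>C rank_one_proj (b i)))"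

definition double_op_integral ::
    "(complex \<Rightarrow> complex \<Rightarrow> complex) \<Rightarrow> complex ^ 'n ^ 'n \<Rightarrow> complex ^ 'n ^ 'n \<Rightarrow>
     complex ^ 'n ^ 'n \<Rightarrow> complex ^ 'n ^ 'n"
  where "double_op_integral \<phi> U0 U1 X =
    (THE R. \<exists>b0 z0 b1 z1. eigenbasis U0 b0 z0 \<and> eigenbasis U1 b1 z1 \<and>
      R = (\<Sum>i\<in>UNIV. \<Sum>k\<in>UNIV. \<phi> (z0 i) (z1 k) *\<^sub>C
            (rank_one_proj (b0 i) ** X ** rank_one_proj (b1 k))))"

definition triple_op_integral ::
    "(complex \<Rightarrow> complex \<Rightarrow> complex \<Rightarrow> complex) \<Rightarrow>
     complex ^ 'n ^ 'n \<Rightarrow> complex ^ 'n ^ 'n \<Rightarrow> complex ^ 'n ^ 'n \<Rightarrow>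
     complex ^ 'n ^ 'n \<Rightarrow> complex ^ 'n ^ 'n \<Rightarrow> complex ^ 'n ^ 'n"
  where "triple_op_integral \<psi> U0 U1 U2 X Y =
    (THE R. \<exists>b0 z0 b1 z1 b2 z2.
      eigenbasis U0 b0 z0 \<and> eigenbasis U1 b1 z1 \<and> eigenbasis U2 b2 z2 \<and>
      R = (\<Sum>i\<in>UNIV. \<Sum>j\<in>UNIV. \<Sum>k\<in>UNIV. \<psi> (z0 i) (z1 k) (z2 j) *\<^sub>C
            (rank_one_proj (b0 i) ** X ** rank_one_proj (b1 k) ** Y ** rank_one_proj (b2 j))))"

section \<open>Smooth functions on the circle and divided differences\<close>

abbreviation unit_circle :: "complex set"
  where "unit_circle \<equiv> sphere 0 1"

text \<open>Functions on the circle are total functions on \<open>complex\<close>; the notions below depend only on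
  the values on \<open>unit_circle\<close>. Differentiation is along the circle, in the complex variable \<open>z\<close>
  (not in the angle); \<open>circle_deriv f z0\<close> is meaningful where the limit exists.\<close>

definition circle_deriv :: "(complex \<Rightarrow> complex) \<Rightarrow> complex \<Rightarrow> complex"
  where "circle_deriv f z0 = Lim (at z0 within unit_circle) (\<lambda>z. (f z - f z0) / (z - z0))"

fun C_circle :: "nat \<Rightarrow> (complex \<Rightarrow> complex) \<Rightarrow> bool"
  where
    "C_circle 0 f \<longleftrightarrow> continuous_on unit_circle f"
  | "C_circle (Suc k) f \<longleftrightarrow>
       (\<forall>z\<in>unit_circle. f field_differentiable (at z within unit_circle)) \<and>
       C_circle k (circle_deriv f)"

definition divdiff1 :: "(complex \<Rightarrow> complex) \<Rightarrow> complex \<Rightarrow> complex \<Rightarrow> complex"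
  where "divdiff1 f z0 z1 =
    (if z0 \<noteq> z1 then (f z0 - f z1) / (z0 - z1) else circle_deriv f z0)"

definition divdiff2 :: "(complex \<Rightarrow> complex) \<Rightarrow> complex \<Rightarrow> complex \<Rightarrow> complex \<Rightarrow> complex"
  where "divdiff2 f z0 z1 z2 =
    (if z0 \<noteq> z2 then (divdiff1 f z0 z1 - divdiff1 f z1 z2) / (z0 - z2)
     else circle_deriv (\<lambda>z. divdiff1 f z z1) z0)"

end

theory Submission
  imports Defs "HOL-Computational_Algebra.Fundamental_Theorem_Algebra"
begin

text \<open>
  Write \<open>V = e\<^sup>i\<^sup>Z U\<close> with eigenprojections \<open>P\<^sub>i\<close> and eigenvalues \<open>z\<^sub>i\<close>, and let \<open>Q\<^sub>k\<close>, \<open>w\<^sub>k\<close> be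
  those of \<open>U\<close>. Everything rests on \<open>P\<^sub>i (V - U) Q\<^sub>k = (z\<^sub>i - w\<^sub>k) P\<^sub>i Q\<^sub>k\<close>. Multiplied by
  divided differences and summed, it gives \<open>f(V) - f(U) = T(V - U)\<close> for the double operator
  integral \<open>T\<close> of \<open>f\<^sup>[\<^sup>1\<^sup>]\<close> over \<open>V, U\<close>, and shows that the triple operator integral of
  \<open>f\<^sup>[\<^sup>2\<^sup>]\<close> at \<open>(V - U, Y)\<close> is the difference of the double ones of \<open>f\<^sup>[\<^sup>1\<^sup>]\<close> over \<open>V, U\<close> and
  over \<open>U, U\<close> at \<open>Y\<close>. Along \<open>e\<^sup>i\<^sup>t\<^sup>Z U\<close> the first identity, divided by \<open>t\<close>, together with continuity
  of the functional calculus, yields the derivative as the double operator integral over \<open>U, U\<close>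
  at \<open>iZU\<close>.
\<close>

section \<open>Complex scalars and adjoints\<close>

lemma cscale_component [simp]: "(c *\<^sub>C A) $ i $ j = c * A $ i $ j"
  by (simp add: cscale_def)

lemma cscale_1 [simp]: "1 *\<^sub>C A = A"
  and cscale_0_right [simp]: "c *\<^sub>C 0 = 0"
  and cscale_cscale [simp]: "c *\<^sub>C d *\<^sub>C A = (c * d) *\<^sub>C A"
  by (simp_all add: vec_eq_iff mult.assoc)

lemma cscale_diff_left: "(c - d) *\<^sub>C A = c *\<^sub>C A - d *\<^sub>C A"
  by (simp add: vec_eq_iff algebra_simps)

lemma cscale_add_right: "c *\<^sub>C (A + B) = c *\<^sub>C A + c *\<^sub>C B"
  by (simp add: vec_eq_iff algebra_simps)

lemma cscale_diff_right: "c *\<^sub>C (A - B) = c *\<^sub>C A - c *\<^sub>C B"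
  by (simp add: vec_eq_iff algebra_simps)

lemma cscale_sum_right: "c *\<^sub>C (\<Sum>i\<in>S. A i) = (\<Sum>i\<in>S. c *\<^sub>C A i)"
  by (simp add: vec_eq_iff sum_distrib_left)

lemma matrix_mult_cscale_left [simp]: "(c *\<^sub>C A) ** B = c *\<^sub>C (A ** B)"
  by (simp add: vec_eq_iff matrix_matrix_mult_def sum_distrib_left mult.assoc)

lemma matrix_mult_cscale_right [simp]: "A ** (c *\<^sub>C B) = c *\<^sub>C (A ** B)"
  by (simp add: vec_eq_iff matrix_matrix_mult_def sum_distrib_left algebra_simps)

lemma norm_cscale: "norm (c *\<^sub>C A) = norm c * norm A"
  by (simp add: norm_vec_def norm_mult L2_set_right_distrib)

lemma bounded_linear_cscale_left: "bounded_linear (\<lambda>c. c *\<^sub>C A)"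
  by (rule bounded_linear_intro[where K="norm A"])
     (simp_all add: norm_cscale, simp_all add: vec_eq_iff algebra_simps)

text \<open>In finite dimension bilinearity already implies boundedness. Sums, differences, limits
  and derivatives of matrix products then follow from the general rules.\<close>

lemma bounded_bilinear_cmatrix_mult:
  "bounded_bilinear ((**) :: complex ^ 'n ^ 'n \<Rightarrow> complex ^ 'n ^ 'n \<Rightarrow> complex ^ 'n ^ 'n)"
  unfolding bilinear_conv_bounded_bilinear[symmetric] bilinear_def
  by (auto intro!: linearI simp: matrix_add_ldistrib matrix_matrix_mult_def vec_eq_iff
      sum.distrib sum_distrib_left scaleR_sum_right algebra_simps)

lemmas matrix_sum_left = bounded_bilinear.sum_left[OF bounded_bilinear_cmatrix_mult]
lemmas matrix_sum_right = bounded_bilinear.sum_right[OF bounded_bilinear_cmatrix_mult]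
lemmas matrix_diff_left = bounded_bilinear.diff_left[OF bounded_bilinear_cmatrix_mult]
lemmas matrix_diff_right = bounded_bilinear.diff_right[OF bounded_bilinear_cmatrix_mult]
lemmas matrix_add_left = bounded_bilinear.add_left[OF bounded_bilinear_cmatrix_mult]

lemma cadjoint_mult: "cadjoint (A ** B) = cadjoint B ** cadjoint A"
  by (simp add: cadjoint_def matrix_matrix_mult_def vec_eq_iff mult.commute)

lemma cadjoint_cscale: "cadjoint (c *\<^sub>C A) = cnj c *\<^sub>C cadjoint A"
  by (simp add: cadjoint_def vec_eq_iff)

lemma cadjoint_sum: "cadjoint (\<Sum>i\<in>S. A i) = (\<Sum>i\<in>S. cadjoint (A i))"
  by (simp add: cadjoint_def vec_eq_iff)

lemma cadjoint_rank_one_proj [simp]: "cadjoint (rank_one_proj v) = rank_one_proj v"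
  by (simp add: cadjoint_def rank_one_proj_def vec_eq_iff)

section \<open>The Hermitian inner product\<close>

lemma cinner_add_left: "cinner (x + y) w = cinner x w + cinner y w"
  by (simp add: cinner_def sum.distrib algebra_simps)

lemma cinner_diff_left: "cinner (x - y) w = cinner x w - cinner y w"
  by (simp add: cinner_def sum_subtractf algebra_simps)

lemma cinner_diff_right: "cinner x (y - w) = cinner x y - cinner x w"
  by (simp add: cinner_def sum_subtractf algebra_simps)

lemma cinner_scale_left: "cinner (c *s x) w = c * cinner x w"
  by (simp add: cinner_def sum_distrib_left mult.assoc)

lemma cinner_scale_right: "cinner x (c *s w) = cnj c * cinner x w"
  by (simp add: cinner_def sum_distrib_left algebra_simps)

lemma cinner_commute: "cinner y x = cnj (cinner x y)"
  by (simp add: cinner_def mult.commute)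

lemma cinner_0_left [simp]: "cinner 0 x = 0"
  by (simp add: cinner_def)

lemma cinner_matrix_left: "cinner (A *v x) y = cinner x (cadjoint A *v y)"
proof -
  have "cinner (A *v x) y = (\<Sum>i\<in>UNIV. \<Sum>j\<in>UNIV. A $ i $ j * x $ j * cnj (y $ i))"
    by (simp add: cinner_def matrix_vector_mult_def sum_distrib_right)
  also have "\<dots> = (\<Sum>j\<in>UNIV. \<Sum>i\<in>UNIV. A $ i $ j * x $ j * cnj (y $ i))"
    by (rule sum.swap)
  also have "\<dots> = cinner x (cadjoint A *v y)"
    by (simp add: cinner_def matrix_vector_mult_def cadjoint_def sum_distrib_left algebra_simps)
  finally show ?thesis .
qed

lemma cinner_self: "cinner x x = of_real (\<Sum>i\<in>UNIV. (norm (x $ i))\<^sup>2)"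
  by (simp only: cinner_def complex_norm_square of_real_sum)

lemma cinner_self_eq_0_iff [simp]: "cinner x x = 0 \<longleftrightarrow> x = 0"
  by (simp add: cinner_self of_real_eq_0_iff sum_nonneg_eq_0_iff vec_eq_iff del: of_real_sum)

lemma normalize_cinner:
  assumes "x \<noteq> 0"
  obtains c where "cinner (c *s x) (c *s x) = 1"
proof -
  define r where "r = (\<Sum>i\<in>UNIV. (norm (x $ i))\<^sup>2)"
  have r: "cinner x x = of_real r"
    by (simp add: cinner_self r_def del: of_real_sum)
  have "r \<ge> 0" by (simp add: r_def sum_nonneg)
  moreover have "r \<noteq> 0" using assms r by (metis cinner_self_eq_0_iff of_real_0)
  ultimately have "r > 0" by simp
  show thesis
  proof (rule that)
    have "cinner (of_real (1 / sqrt r) *s x) (of_real (1 / sqrt r) *s x)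
        = of_real (1 / sqrt r * (1 / sqrt r) * r)"
      by (simp only: cinner_scale_left cinner_scale_right r complex_cnj_complex_of_real of_real_mult mult.assoc)
    also have "1 / sqrt r * (1 / sqrt r) * r = 1"
      using \<open>r > 0\<close> by (simp add: field_simps)
    finally show "cinner (of_real (1 / sqrt r) *s x) (of_real (1 / sqrt r) *s x) = 1" by simp
  qed
qed

section \<open>Spectral theorem for normal matrices\<close>

definition poly_orbit :: "complex ^ 'n ^ 'n \<Rightarrow> complex poly \<Rightarrow> complex ^ 'n \<Rightarrow> complex ^ 'n"
  where "poly_orbit A p v = (\<Sum>i\<le>degree p. coeff p i *s (((*v) A ^^ i) v))"

text \<open>Coefficients beyond the degree vanish, so polynomials of different degrees can be
  compared over a common summation range.\<close>

lemma poly_orbit_eq: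
  assumes "degree p \<le> N"
  shows "poly_orbit A p v = (\<Sum>i\<le>N. coeff p i *s (((*v) A ^^ i) v))"
  unfolding poly_orbit_def using assms
  by (intro sum.mono_neutral_left) (auto simp: coeff_eq_0)

lemma poly_orbit_linear_factor:
  "poly_orbit A ([:- c, 1:] * q) v = A *v poly_orbit A q v - c *s poly_orbit A q v"
proof -
  let ?T = "\<lambda>i. ((*v) A ^^ i) v"
  let ?N = "degree q"
  have "degree ([:- c, 1:] * q) \<le> Suc ?N"
    using degree_mult_le[of "[:- c, 1:]" q] by simp
  then have "poly_orbit A ([:- c, 1:] * q) v
      = (\<Sum>i\<le>Suc ?N. coeff ([:- c, 1:] * q) i *s ?T i)"
    by (rule poly_orbit_eq)
  also have "\<dots> = (\<Sum>i\<le>Suc ?N. coeff (pCons 0 q) i *s ?T i) - (\<Sum>i\<le>Suc ?N. (c * coeff q i) *s ?T i)"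
    unfolding sum_subtractf[symmetric] by (rule sum.cong) (auto simp: vec_eq_iff algebra_simps)
  also have "(\<Sum>i\<le>Suc ?N. coeff (pCons 0 q) i *s ?T i) = (\<Sum>i\<le>?N. coeff q i *s (A *v ?T i))"
    by (subst sum.atMost_Suc_shift) simp
  also have "\<dots> = A *v poly_orbit A q v"
    by (simp add: poly_orbit_def vec.sum vec.scale)
  also have "(\<Sum>i\<le>Suc ?N. (c * coeff q i) *s ?T i) = c *s poly_orbit A q v"
    by (simp add: poly_orbit_def vec.scale_sum_right coeff_eq_0)
  finally show ?thesis .
qed

text \<open>The \<open>n + 1\<close> iterates of \<open>v\<close> up to exponent \<open>n\<close>
  are linearly dependent, and the coefficients of a dependence form \<open>p\<close>. Dependence is
  a property of the set of iterates, so a repetition among them is treated apart: there a difference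
  of two monomials annihilates \<open>v\<close>.\<close>

lemma annihilating_poly_exists:
  fixes A :: "complex ^ 'n ^ 'n"
  obtains p where "p \<noteq> 0" "poly_orbit A p v = 0"
proof (cases "inj_on (\<lambda>i. ((*v) A ^^ i) v) {..CARD('n)}")
  case True
  let ?T = "\<lambda>i. ((*v) A ^^ i) v"
  let ?S = "?T ` {..CARD('n)}"
  have "card ?S > vec.dim ?S"
    using vec.dim_subset[of ?S UNIV] by (simp add: card_image[OF True] vec_dim_card del: vec.dim_UNIV)
  then have "vec.dependent ?S"
    by (rule vec.dependent_biggerset_general)
  then obtain u where u: "\<exists>w\<in>?S. u w \<noteq> 0" "(\<Sum>w\<in>?S. u w *s w) = 0"
    by (auto simp: vec.dependent_finite)
  define p where "p = (\<Sum>i\<le>CARD('n). monom (u (?T i)) i)"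
  have coeff: "coeff p i = (if i \<le> CARD('n) then u (?T i) else 0)" for i
    by (simp add: p_def coeff_sum)
  have "p \<noteq> 0"
    using u(1) coeff by (metis (no_types, lifting) atMost_iff coeff_0 imageE)
  moreover have "poly_orbit A p v = 0"
  proof -
    have "degree p \<le> CARD('n)" by (rule degree_le) (simp add: coeff)
    then have "poly_orbit A p v = (\<Sum>i\<le>CARD('n). u (?T i) *s ?T i)"
      by (simp add: poly_orbit_eq coeff)
    also have "\<dots> = 0" using u(2) by (simp add: sum.reindex[OF True])
    finally show ?thesis .
  qed
  ultimately show ?thesis by (rule that)
next
  case False
  then obtain i j where ij: "i \<noteq> j" "((*v) A ^^ i) v = ((*v) A ^^ j) v"
    by (auto simp: inj_on_def)
  define p :: "complex poly" where "p = monom 1 i - monom 1 j"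
  have "coeff p i = 1" using ij by (simp add: p_def)
  then have "p \<noteq> 0" by auto
  moreover have "poly_orbit A p v = 0"
  proof -
    have "degree p \<le> i + j"
      unfolding p_def by (intro degree_diff_le) (auto intro: order.trans[OF degree_monom_le])
    then have "poly_orbit A p v = (\<Sum>k\<le>i+j. coeff p k *s ((*v) A ^^ k) v)"
      by (rule poly_orbit_eq)
    also have "\<dots> = (\<Sum>k\<le>i+j. (if k = i then ((*v) A ^^ i) v else 0) - (if k = j then ((*v) A ^^ j) v else 0))"
      by (rule sum.cong) (auto simp: p_def)
    also have "\<dots> = 0" using ij by (simp add: sum_subtractf)
    finally show ?thesis .
  qed
  ultimately show ?thesis by (rule that)
qed

text \<open>An annihilating polynomial of minimal degree has a root \<open>c\<close>; by minimality
  the cofactor \<open>q\<close> of its linear factor does not annihilate \<open>v\<close>, while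
  \<open>A - c\<close> kills \<open>q(A) v\<close>. That the eigenvector is a polynomial in
  \<open>A\<close> applied to \<open>v\<close> keeps it in every \<open>A\<close>-invariant subspace
  containing \<open>v\<close>.\<close>

lemma eigenvector_in_orbit:
  fixes A :: "complex ^ 'n ^ 'n"
  assumes "v \<noteq> 0"
  obtains q c where "poly_orbit A q v \<noteq> 0" "A *v poly_orbit A q v = c *s poly_orbit A q v"
proof -
  define P where "P = (\<lambda>p. p \<noteq> 0 \<and> poly_orbit A p v = 0)"
  have "\<exists>p. P p" unfolding P_def using annihilating_poly_exists by blast
  then obtain p where p: "P p" and min: "\<And>q. P q \<Longrightarrow> degree p \<le> degree q"
    using exists_least_lemma ex_has_least_nat[of P _ degree] by metis
  have "degree p \<noteq> 0"
  proof
    assume 0: "degree p = 0"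
    then have "coeff p 0 *s v = 0" using p by (simp add: P_def poly_orbit_def)
    then show False using 0 p assms
      by (metis P_def leading_coeff_0_iff vector_mul_eq_0)
  qed
  then have "\<not> constant (poly p)" by (simp add: constant_degree)
  then obtain c where "poly p c = 0" using fundamental_theorem_of_algebra by blast
  then obtain q where q: "p = [:- c, 1:] * q" by (metis dvdE poly_eq_0_iff_dvd)
  have "q \<noteq> 0" using p q by (auto simp: P_def)
  have "degree p = Suc (degree q)"
    unfolding q using \<open>q \<noteq> 0\<close> by (subst degree_mult_eq) auto
  then have "poly_orbit A q v \<noteq> 0"
    using min[of q] \<open>q \<noteq> 0\<close> by (auto simp: P_def)
  moreover have "A *v poly_orbit A q v = c *s poly_orbit A q v"
    using p poly_orbit_linear_factor[of A c q v] by (simp add: P_def q)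
  ultimately show thesis by (rule that)
qed

text \<open>By normality \<open>cadjoint A *v x\<close> satisfies the same eigenvalue equation for
  \<open>A\<close> as \<open>x\<close>; the four terms of \<open>cinner y y\<close> then cancel in
  pairs.\<close>

lemma normal_adjoint_eigenvector:
  assumes normal: "cadjoint A ** A = A ** cadjoint A" and "A *v x = c *s x"
  shows "cadjoint A *v x = cnj c *s x"
proof -
  define y where "y = cadjoint A *v x - cnj c *s x"
  have swap: "cinner u (cadjoint A *v x) = cinner (A *v u) x" for u
    by (simp add: cinner_matrix_left)
  have "A *v (cadjoint A *v x) = c *s (cadjoint A *v x)"
    by (metis assms matrix_vector_mul_assoc vec.scale)
  then have "cinner y y = 0"
    by (simp add: y_def cinner_diff_left cinner_diff_right swap cinner_scale_left cinner_scale_right assms(2) vec.diff vec.scale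
        algebra_simps)
  then show ?thesis by (simp add: y_def)
qed

text \<open>Induction on the index set adds one eigenvector at a time. The vectors found so far are
  eigenvectors of \<open>cadjoint A\<close> too, so their orthogonal complement is
  \<open>A\<close>-invariant and contains the next eigenvector, taken from the orbit of any nonzero
  vector in it.\<close>

lemma normal_eigenbasis_exists:
  fixes A :: "complex ^ 'n ^ 'n"
  assumes normal: "cadjoint A ** A = A ** cadjoint A"
  obtains b z where "eigenbasis A b z"
proof -
  have "\<exists>b z. (\<forall>i\<in>S. \<forall>j\<in>S. cinner (b i) (b j) = (if i = j then 1 else 0)) \<and>
      (\<forall>i\<in>S. A *v b i = z i *s b i)" if "finite S" for S :: "'n set"
    using that
  proof (induction S)
    case empty
    then show ?case by simp
  next
    case (insert k S)
    then obtain b z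
      where b: "\<And>i j. i \<in> S \<Longrightarrow> j \<in> S \<Longrightarrow> cinner (b i) (b j) = (if i = j then 1 else 0)"
        and z: "\<And>i. i \<in> S \<Longrightarrow> A *v b i = z i *s b i" by blast
    txt \<open>Row \<open>k\<close> of \<open>M\<close> vanishes, so \<open>M\<close> is singular, and a kernel vector is orthogonal to all
      \<open>b i\<close> with \<open>i \<in> S\<close>.\<close>
    define M :: "complex ^ 'n ^ 'n" where "M = (\<chi> i j. if i \<in> S then cnj (b i $ j) else 0)"
    have "M ** B \<noteq> mat 1" for B
    proof
      assume "M ** B = mat 1"
      then have "(M ** B) $ k $ k = 1" by (simp add: mat_def)
      then show False
        using insert.hyps by (simp add: M_def matrix_matrix_mult_def)
    qed
    then have "\<nexists>B. M ** B = mat 1" by blast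
    then have "\<nexists>B. B ** M = mat 1"
      by (simp add: matrix_left_right_inverse)
    then obtain v where v: "M *v v = 0" "v \<noteq> 0"
      by (auto simp: matrix_left_invertible_ker)
    have v_orth: "cinner v (b i) = 0" if "i \<in> S" for i
    proof -
      have "(M *v v) $ i = 0" by (simp add: v)
      then show ?thesis using that
        by (simp add: M_def matrix_vector_mult_def cinner_def mult.commute)
    qed
    have inv: "cinner (A *v x) (b i) = 0" if "i \<in> S" "cinner x (b i) = 0" for x i
      using that normal_adjoint_eigenvector[OF normal z]
      by (simp add: cinner_matrix_left cinner_scale_right)
    have orbit: "cinner (((*v) A ^^ m) v) (b i) = 0" if "i \<in> S" for i m
      by (induction m) (use that v_orth inv in auto)
    have poly: "cinner (poly_orbit A q v) (b i) = 0" if "i \<in> S" for i q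
    proof -
      have "cinner (\<Sum>m\<in>I. coeff q m *s ((*v) A ^^ m) v) (b i) = 0" if "finite I" for I
        using that orbit[OF \<open>i \<in> S\<close>]
        by (induction I) (simp_all add: cinner_add_left cinner_scale_left)
      then show ?thesis by (simp add: poly_orbit_def)
    qed
    obtain q c where w: "poly_orbit A q v \<noteq> 0" "A *v poly_orbit A q v = c *s poly_orbit A q v"
      using eigenvector_in_orbit[OF \<open>v \<noteq> 0\<close>] by blast
    obtain r where r: "cinner (r *s poly_orbit A q v) (r *s poly_orbit A q v) = 1"
      using normalize_cinner[OF w(1)] by blast
    define e where "e = r *s poly_orbit A q v"
    have e: "cinner e e = 1" "A *v e = c *s e" "\<And>i. i \<in> S \<Longrightarrow> cinner e (b i) = 0"
      "\<And>i. i \<in> S \<Longrightarrow> cinner (b i) e = 0"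
      using r w(2) poly
      by (simp_all add: e_def vec.scale cinner_scale_left cinner_scale_right mult.commute
          cinner_commute[of "b _"])
    show ?case
      by (rule exI[of _ "b(k := e)"], rule exI[of _ "z(k := c)"])
        (use e b z insert.hyps in auto)
  qed
  from this[of UNIV] show thesis
    using that by (auto simp: eigenbasis_def orthonormal_basis_def)
qed

section \<open>Eigenprojections\<close>

lemma rank_one_proj_mult:
  "rank_one_proj u ** rank_one_proj v = cinner v u *\<^sub>C (\<chi> i j. u $ i * cnj (v $ j))"
  by (simp add: rank_one_proj_def matrix_matrix_mult_def vec_eq_iff cinner_def
      sum_distrib_left sum_distrib_right algebra_simps)

lemma matrix_mult_rank_one_proj:
  "A ** rank_one_proj v = (\<chi> i j. (A *v v) $ i * cnj (v $ j))"
  by (simp add: rank_one_proj_def matrix_matrix_mult_def matrix_vector_mult_def vec_eq_iff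
      sum_distrib_right mult.assoc)

lemma orthonormal_proj_mult:
  assumes "orthonormal_basis b"
  shows "rank_one_proj (b i) ** rank_one_proj (b j) = (if i = j then rank_one_proj (b i) else 0)"
  using assms unfolding rank_one_proj_mult orthonormal_basis_def
  by (auto simp: vec_eq_iff rank_one_proj_def)

text \<open>Orthonormality of the rows of a square matrix gives a one-sided inverse, hence a
  two-sided one; the reversed product expresses completeness.\<close>

lemma sum_orthonormal_proj:
  fixes b :: "'n \<Rightarrow> complex ^ 'n"
  assumes "orthonormal_basis b"
  shows "(\<Sum>i\<in>UNIV. rank_one_proj (b i)) = mat 1"
proof -
  define B :: "complex ^ 'n ^ 'n" where "B = (\<chi> i. b i)"
  have "B ** cadjoint B = mat 1"
    using assms
    by (simp add: B_def cadjoint_def matrix_matrix_mult_def vec_eq_iff mat_def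
        orthonormal_basis_def cinner_def)
  then have "cadjoint B ** B = mat 1"
    by (simp add: matrix_left_right_inverse)
  then have *: "(cadjoint B ** B) $ k $ l = (if k = l then 1 else 0)" for k l
    by (simp add: mat_def)
  \<comment> \<open>The basis vectors are the rows of \<open>B\<close>, so the sum of projections is
    the transpose of \<open>cadjoint B ** B\<close>; hence the swapped indices.\<close>
  have "(\<Sum>i\<in>UNIV. rank_one_proj (b i)) $ k $ l = (if k = l then 1 else 0)" for k l
    using *[of l k]
    by (auto simp: rank_one_proj_def B_def cadjoint_def matrix_matrix_mult_def mult.commute)
  then show ?thesis
    by (simp add: vec_eq_iff mat_def)
qed

lemma orthonormal_spectral_mult:
  assumes "orthonormal_basis b"
  shows "(\<Sum>i\<in>UNIV. x i *\<^sub>C rank_one_proj (b i)) ** (\<Sum>i\<in>UNIV. y i *\<^sub>C rank_one_proj (b i))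
    = (\<Sum>i\<in>UNIV. (x i * y i) *\<^sub>C rank_one_proj (b i))"
  by (simp add: matrix_sum_left matrix_sum_right orthonormal_proj_mult[OF assms]
      if_distrib[where f="\<lambda>A. c *\<^sub>C A" for c] mult.commute cong: if_cong)

lemma eigenbasis_mult_proj:
  assumes "eigenbasis U b z"
  shows "U ** rank_one_proj (b i) = z i *\<^sub>C rank_one_proj (b i)"
  using assms
  by (simp add: matrix_mult_rank_one_proj eigenbasis_def)
     (simp add: vec_eq_iff rank_one_proj_def mult.assoc)

lemma eigenbasis_eq_sum:
  assumes "eigenbasis U b z"
  shows "U = (\<Sum>i\<in>UNIV. z i *\<^sub>C rank_one_proj (b i))"
proof -
  have "U = U ** (\<Sum>i\<in>UNIV. rank_one_proj (b i))"
    using assms by (simp add: eigenbasis_def sum_orthonormal_proj)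
  then show ?thesis
    by (simp add: matrix_sum_right eigenbasis_mult_proj[OF assms])
qed

lemma eigenbasis_proj_mult:
  assumes "eigenbasis U b z"
  shows "rank_one_proj (b i) ** U = z i *\<^sub>C rank_one_proj (b i)"
proof -
  have "orthonormal_basis b" using assms by (simp add: eigenbasis_def)
  then show ?thesis
    by (subst eigenbasis_eq_sum[OF assms])
       (simp add: matrix_sum_right orthonormal_proj_mult if_distrib[where f="\<lambda>A. c *\<^sub>C A" for c]
         cong: if_cong)
qed

lemma proj_mult_diff_mult_proj:
  assumes "eigenbasis V b z" and "eigenbasis U c w"
  shows "rank_one_proj (b i) ** (V - U) ** rank_one_proj (c k)
    = (z i - w k) *\<^sub>C (rank_one_proj (b i) ** rank_one_proj (c k))"
proof -
  have "rank_one_proj (b i) ** (V - U) ** rank_one_proj (c k)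
      = rank_one_proj (b i) ** V ** rank_one_proj (c k)
        - rank_one_proj (b i) ** (U ** rank_one_proj (c k))"
    by (simp add: matrix_diff_left matrix_diff_right matrix_mul_assoc)
  also have "\<dots> = (z i - w k) *\<^sub>C (rank_one_proj (b i) ** rank_one_proj (c k))"
    by (simp add: eigenbasis_proj_mult[OF assms(1)] eigenbasis_mult_proj[OF assms(2)] cscale_diff_left)
  finally show ?thesis .
qed

text \<open>Both sums refine to sums over the products of the two families of projections, and such
  a product vanishes unless the eigenvalues agree. Leaving \<open>G\<close> an arbitrary additive
  map lets the lemma act on one slot of an operator integral at a time.\<close>

lemma eigenbasis_change:
  fixes G :: "complex \<Rightarrow> complex ^ 'n ^ 'n \<Rightarrow> complex ^ 'n ^ 'n"
  assumes b: "eigenbasis U b z" and b': "eigenbasis U b' z'"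
    and add: "\<And>c A B. G c (A + B) = G c A + G c B"
  shows "(\<Sum>i\<in>UNIV. G (z i) (rank_one_proj (b i))) = (\<Sum>i\<in>UNIV. G (z' i) (rank_one_proj (b' i)))"
proof -
  let ?P = "\<lambda>i. rank_one_proj (b i)" and ?P' = "\<lambda>i. rank_one_proj (b' i)"
  have additive: "Modules.additive (G c)" for c
    by unfold_locales (rule add)
  have "z i = z' j \<or> ?P i ** ?P' j = 0" for i j
  proof -
    have "(z i - z' j) *\<^sub>C (?P i ** ?P' j) = 0"
      using proj_mult_diff_mult_proj[OF b b', of i j] by simp
    then show ?thesis by (simp add: vec_eq_iff)
  qed
  then have swap: "G (z i) (?P i ** ?P' j) = G (z' j) (?P i ** ?P' j)" for i j
    using Modules.additive.zero[OF additive] by metis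
  have left: "?P i = (\<Sum>j\<in>UNIV. ?P i ** ?P' j)" for i
    using b' by (simp add: matrix_sum_right[symmetric] sum_orthonormal_proj eigenbasis_def)
  have right: "?P' j = (\<Sum>i\<in>UNIV. ?P i ** ?P' j)" for j
    using b by (simp add: matrix_sum_left[symmetric] sum_orthonormal_proj eigenbasis_def)
  have "(\<Sum>i\<in>UNIV. G (z i) (?P i)) = (\<Sum>i\<in>UNIV. \<Sum>j\<in>UNIV. G (z i) (?P i ** ?P' j))"
    by (subst left) (simp add: Modules.additive.sum[OF additive])
  also have "\<dots> = (\<Sum>j\<in>UNIV. \<Sum>i\<in>UNIV. G (z' j) (?P i ** ?P' j))"
    by (subst sum.swap) (simp add: swap)
  also have "\<dots> = (\<Sum>j\<in>UNIV. G (z' j) (?P' j))"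
    by (subst (2) right) (simp add: Modules.additive.sum[OF additive])
  finally show ?thesis .
qed

text \<open>Uniqueness of the described value is \<open>eigenbasis_change\<close>, so any convenient
  eigenbasis may be used to compute it.\<close>

lemma fun_calc_eq:
  assumes "eigenbasis U b z"
  shows "fun_calc f U = (\<Sum>i\<in>UNIV. f (z i) *\<^sub>C rank_one_proj (b i))"
  unfolding fun_calc_def
proof (rule the_equality)
  fix R
  assume "\<exists>b z. eigenbasis U b z \<and> R = (\<Sum>i\<in>UNIV. f (z i) *\<^sub>C rank_one_proj (b i))"
  then obtain b' z' where b': "eigenbasis U b' z'"
      and R: "R = (\<Sum>i\<in>UNIV. f (z' i) *\<^sub>C rank_one_proj (b' i))" by blast
  show "R = (\<Sum>i\<in>UNIV. f (z i) *\<^sub>C rank_one_proj (b i))"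
    unfolding R by (rule eigenbasis_change[OF b' assms]) (rule cscale_add_right)
qed (use assms in blast)

lemma double_op_integral_eq:
  assumes b0: "eigenbasis U0 b0 z0" and b1: "eigenbasis U1 b1 z1"
  shows "double_op_integral \<phi> U0 U1 X = (\<Sum>i\<in>UNIV. \<Sum>k\<in>UNIV. \<phi> (z0 i) (z1 k) *\<^sub>C
    (rank_one_proj (b0 i) ** X ** rank_one_proj (b1 k)))"
  unfolding double_op_integral_def
proof (rule the_equality)
  let ?S = "\<lambda>b0 z0 b1 z1. \<Sum>i\<in>UNIV. \<Sum>k\<in>UNIV. \<phi> (z0 i) (z1 k) *\<^sub>C
    (rank_one_proj (b0 i) ** X ** rank_one_proj (b1 k))"
  fix R
  assume "\<exists>b0 z0 b1 z1. eigenbasis U0 b0 z0 \<and> eigenbasis U1 b1 z1 \<and> R = ?S b0 z0 b1 z1"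
  then obtain b0' z0' b1' z1' where b0': "eigenbasis U0 b0' z0'" and b1': "eigenbasis U1 b1' z1'"
      and R: "R = ?S b0' z0' b1' z1'" by blast
  have "?S b0' z0' b1' z1' = ?S b0 z0 b1' z1'"
    by (rule eigenbasis_change[OF b0' b0])
       (simp add: matrix_add_left cscale_add_right sum.distrib)
  also have "\<dots> = ?S b0 z0 b1 z1"
    by (rule sum.cong[OF refl], rule eigenbasis_change[OF b1' b1])
       (simp add: matrix_add_ldistrib cscale_add_right)
  finally show "R = ?S b0 z0 b1 z1" by (simp add: R)
qed (use assms in blast)

lemma triple_op_integral_eq:
  assumes b0: "eigenbasis U0 b0 z0" and b1: "eigenbasis U1 b1 z1" and b2: "eigenbasis U2 b2 z2"
  shows "triple_op_integral \<psi> U0 U1 U2 X Y =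
    (\<Sum>i\<in>UNIV. \<Sum>j\<in>UNIV. \<Sum>k\<in>UNIV. \<psi> (z0 i) (z1 k) (z2 j) *\<^sub>C
      (rank_one_proj (b0 i) ** X ** rank_one_proj (b1 k) ** Y ** rank_one_proj (b2 j)))"
  unfolding triple_op_integral_def
proof (rule the_equality)
  let ?S = "\<lambda>b0 z0 b1 z1 b2 z2. \<Sum>i\<in>UNIV. \<Sum>j\<in>UNIV. \<Sum>k\<in>UNIV.
    \<psi> (z0 i) (z1 k) (z2 j) *\<^sub>C
      (rank_one_proj (b0 i) ** X ** rank_one_proj (b1 k) ** Y ** rank_one_proj (b2 j))"
  fix R
  assume "\<exists>b0 z0 b1 z1 b2 z2. eigenbasis U0 b0 z0 \<and> eigenbasis U1 b1 z1 \<and> eigenbasis U2 b2 z2 \<and>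
    R = ?S b0 z0 b1 z1 b2 z2"
  then obtain b0' z0' b1' z1' b2' z2' where b0': "eigenbasis U0 b0' z0'"
      and b1': "eigenbasis U1 b1' z1'" and b2': "eigenbasis U2 b2' z2'"
      and R: "R = ?S b0' z0' b1' z1' b2' z2'" by blast
  have "?S b0' z0' b1' z1' b2' z2' = ?S b0 z0 b1' z1' b2' z2'"
    by (rule eigenbasis_change[OF b0' b0])
       (simp add: matrix_add_left cscale_add_right sum.distrib)
  \<comment> \<open>The third basis is exchanged before the second because the sum over
    \<open>k\<close>, which belongs to the middle operator, is innermost.\<close>
  also have "\<dots> = ?S b0 z0 b1' z1' b2 z2"
    by (rule sum.cong[OF refl], rule eigenbasis_change[OF b2' b2])
       (simp add: matrix_add_ldistrib cscale_add_right sum.distrib)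
  also have "\<dots> = ?S b0 z0 b1 z1 b2 z2"
    by (rule sum.cong[OF refl], rule sum.cong[OF refl], rule eigenbasis_change[OF b1' b1])
       (simp add: matrix_add_left matrix_add_ldistrib cscale_add_right)
  finally show "R = ?S b0 z0 b1 z1 b2 z2" by (simp add: R)
qed (use assms in blast)

section \<open>Unitary and self-adjoint matrices\<close>

lemma unitary_eigenbasis_exists:
  assumes "unitary_mat U"
  obtains b z where "eigenbasis U b z"
  using normal_eigenbasis_exists[of U] assms by (auto simp: unitary_mat_def)

lemma unitary_eigenvalue:
  assumes "unitary_mat U" and "eigenbasis U b z"
  shows "z i \<in> unit_circle"
proof -
  have b: "cinner (b i) (b i) = 1" "U *v b i = z i *s b i"
    using assms(2) by (simp_all add: eigenbasis_def orthonormal_basis_def)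
  have "z i * cnj (z i) = cinner (U *v b i) (U *v b i)"
    by (simp add: b cinner_scale_left cinner_scale_right)
  also have "\<dots> = 1"
    using assms(1) b(1)
    by (simp only: cinner_matrix_left matrix_vector_mul_assoc unitary_mat_def matrix_vector_mul_lid)
  finally have "(norm (z i))\<^sup>2 = 1"
    by (metis complex_norm_square of_real_1 of_real_eq_iff)
  then show ?thesis using power2_eq_imp_eq[of "norm (z i)" 1] by simp
qed

lemma unitary_mult:
  assumes "unitary_mat U" and "unitary_mat V"
  shows "unitary_mat (U ** V)"
  using assms unfolding unitary_mat_def cadjoint_mult
  by (metis matrix_mul_assoc matrix_mul_lid)

section \<open>Exponentials of spectral sums and of self-adjoint matrices\<close>

lemma mat_exp_spectral:
  assumes "orthonormal_basis b"
  shows "mat_exp (\<Sum>i\<in>UNIV. a i *\<^sub>C rank_one_proj (b i)) = (\<Sum>i\<in>UNIV. exp (a i) *\<^sub>C rank_one_proj (b i))"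
proof -
  let ?P = "\<lambda>i. rank_one_proj (b i)"
  have power: "mat_power (\<Sum>i\<in>UNIV. a i *\<^sub>C ?P i) k = (\<Sum>i\<in>UNIV. a i ^ k *\<^sub>C ?P i)" for k
  proof (induction k)
    case 0
    then show ?case by (simp add: mat_power_def sum_orthonormal_proj[OF assms])
  next
    case (Suc k)
    then show ?case by (simp add: mat_power_def orthonormal_spectral_mult[OF assms])
  qed
  \<comment> \<open>The projections are fixed, so the matrix series reduces to the scalar
    exponential series of each eigenvalue.\<close>
  have "(\<lambda>k. (a i ^ k /\<^sub>R fact k) *\<^sub>C ?P i) sums (exp (a i) *\<^sub>C ?P i)" for i
    by (rule bounded_linear.sums[OF bounded_linear_cscale_left exp_converges])
  then have "(\<lambda>k. \<Sum>i\<in>UNIV. (a i ^ k /\<^sub>R fact k) *\<^sub>C ?P i) sums (\<Sum>i\<in>UNIV. exp (a i) *\<^sub>C ?P i)"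
    by (rule sums_sum)
  moreover have "(\<Sum>i\<in>UNIV. (a i ^ k /\<^sub>R fact k) *\<^sub>C ?P i)
      = (1 / fact k) *\<^sub>R mat_power (\<Sum>i\<in>UNIV. a i *\<^sub>C ?P i) k" for k
    by (simp add: power vec_eq_iff scaleR_sum_right divide_inverse)
  ultimately show ?thesis
    unfolding mat_exp_def by (simp add: sums_unique[symmetric])
qed

lemma self_adjoint_eigenvalue:
  assumes "self_adjoint_mat Z" and "eigenbasis Z b z"
  shows "z i \<in> \<real>"
proof -
  have b: "cinner (b i) (b i) = 1" "Z *v b i = z i *s b i"
    using assms(2) by (simp_all add: eigenbasis_def orthonormal_basis_def)
  have "cinner (Z *v b i) (b i) = cinner (b i) (Z *v b i)"
    using assms(1) by (simp add: cinner_matrix_left self_adjoint_mat_def)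
  then have "z i = cnj (z i)"
    by (simp add: b cinner_scale_left cinner_scale_right)
  then show ?thesis by (simp add: Reals_cnj_iff)
qed

text \<open>One eigenbasis of \<open>Z\<close> serves all \<open>t\<close>, so unitarity and the
  derivative in \<open>t\<close> become statements about the scalars
  \<open>cis (t * \<zeta> i)\<close>.\<close>

lemma mat_exp_self_adjoint:
  fixes Z :: "complex ^ 'n ^ 'n"
  assumes "self_adjoint_mat Z"
  obtains b and \<zeta> :: "'n \<Rightarrow> real" where "orthonormal_basis b"
    "Z = (\<Sum>i\<in>UNIV. of_real (\<zeta> i) *\<^sub>C rank_one_proj (b i))"
    "\<forall>t. mat_exp ((\<i> * of_real t) *\<^sub>C Z) = (\<Sum>i\<in>UNIV. cis (t * \<zeta> i) *\<^sub>C rank_one_proj (b i))"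
proof -
  obtain b z where bz: "eigenbasis Z b z"
    using normal_eigenbasis_exists[of Z] assms by (auto simp: self_adjoint_mat_def)
  have on: "orthonormal_basis b" using bz by (simp add: eigenbasis_def)
  define \<zeta> where "\<zeta> i = Re (z i)" for i
  have z: "z i = of_real (\<zeta> i)" for i
    using self_adjoint_eigenvalue[OF assms bz, of i] by (simp add: \<zeta>_def)
  have Z: "Z = (\<Sum>i\<in>UNIV. of_real (\<zeta> i) *\<^sub>C rank_one_proj (b i))"
    using eigenbasis_eq_sum[OF bz] by (simp add: z)
  have "mat_exp ((\<i> * of_real t) *\<^sub>C Z) = (\<Sum>i\<in>UNIV. cis (t * \<zeta> i) *\<^sub>C rank_one_proj (b i))" for t
    by (subst Z) (simp add: cscale_sum_right mat_exp_spectral[OF on] cis_conv_exp mult.assoc)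
  with on Z show thesis using that by blast
qed

lemma unitary_mat_exp:
  assumes "self_adjoint_mat Z"
  shows "unitary_mat (mat_exp ((\<i> * of_real t) *\<^sub>C Z))"
proof -
  obtain b \<zeta> where b: "orthonormal_basis b"
      and e: "\<forall>t. mat_exp ((\<i> * of_real t) *\<^sub>C Z) = (\<Sum>i\<in>UNIV. cis (t * \<zeta> i) *\<^sub>C rank_one_proj (b i))"
    using mat_exp_self_adjoint[OF assms] by blast
  show ?thesis
    unfolding e[rule_format] unitary_mat_def cadjoint_sum cadjoint_cscale cadjoint_rank_one_proj
    by (simp add: orthonormal_spectral_mult[OF b] cis_cnj cis_mult sum_orthonormal_proj[OF b])
qed

lemma mat_exp_has_vector_derivative:
  assumes "self_adjoint_mat Z"
  shows "((\<lambda>t. mat_exp ((\<i> * of_real t) *\<^sub>C Z)) has_vector_derivative \<i> *\<^sub>C Z) (at 0)"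
proof -
  obtain b \<zeta> where "orthonormal_basis b"
      and Z: "Z = (\<Sum>i\<in>UNIV. of_real (\<zeta> i) *\<^sub>C rank_one_proj (b i))"
      and e: "\<forall>t. mat_exp ((\<i> * of_real t) *\<^sub>C Z) = (\<Sum>i\<in>UNIV. cis (t * \<zeta> i) *\<^sub>C rank_one_proj (b i))"
    using mat_exp_self_adjoint[OF assms] by blast
  have "((\<lambda>t. cis (t * \<zeta> i)) has_vector_derivative \<i> * of_real (\<zeta> i)) (at 0)" for i
  proof -
    have "((\<lambda>x. exp (\<i> * (x * of_real (\<zeta> i)))) has_field_derivative \<i> * of_real (\<zeta> i))
        (at (of_real 0))"
      by (auto intro!: derivative_eq_intros)
    from has_vector_derivative_real_field[OF this] show ?thesis
      by (simp add: cis_conv_exp)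
  qed
  then have "((\<lambda>t. cis (t * \<zeta> i) *\<^sub>C rank_one_proj (b i)) has_vector_derivative
      (\<i> * of_real (\<zeta> i)) *\<^sub>C rank_one_proj (b i)) (at 0)" for i
    by (rule bounded_linear.has_vector_derivative[OF bounded_linear_cscale_left])
  then have "((\<lambda>t. \<Sum>i\<in>UNIV. cis (t * \<zeta> i) *\<^sub>C rank_one_proj (b i)) has_vector_derivative
      (\<Sum>i\<in>UNIV. (\<i> * of_real (\<zeta> i)) *\<^sub>C rank_one_proj (b i))) (at 0)"
    by (rule has_vector_derivative_sum)
  also have "(\<Sum>i\<in>UNIV. (\<i> * of_real (\<zeta> i)) *\<^sub>C rank_one_proj (b i)) = \<i> *\<^sub>C Z"
    by (simp add: Z cscale_sum_right)
  finally show ?thesis by (simp add: e)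
qed

section \<open>Derivatives and divided differences on the circle\<close>

text \<open>A connected set with more than one point has no isolated points. This makes limits along
  the circle unique, hence \<open>circle_deriv\<close> well determined.\<close>

lemma at_within_circle_neq_bot:
  assumes "z \<in> unit_circle"
  shows "at z within unit_circle \<noteq> bot"
proof -
  have "unit_circle \<noteq> {x}" for x
  proof
    assume *: "unit_circle = {x}"
    have "1 \<in> unit_circle" "- 1 \<in> unit_circle" by simp_all
    then have "(1::complex) = - 1" unfolding * by simp
    then show False by simp
  qed
  then have "z islimpt unit_circle"
    using assms by (intro connected_imp_perfect) (auto intro: connected_sphere)
  then show ?thesis by (simp add: trivial_limit_within)
qed

lemma circle_deriv_eqI:
  assumes "z \<in> unit_circle" and "(f has_field_derivative D) (at z within unit_circle)"
  shows "circle_deriv f z = D"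
  unfolding circle_deriv_def
  using assms by (intro tendsto_Lim at_within_circle_neq_bot) (simp_all add: has_field_derivative_iff)

lemma circle_deriv_works:
  assumes "z \<in> unit_circle" and "f field_differentiable (at z within unit_circle)"
  shows "(f has_field_derivative circle_deriv f z) (at z within unit_circle)"
  using assms circle_deriv_eqI unfolding field_differentiable_def by metis

lemma divdiff1_mult: "divdiff1 f z w * (z - w) = f z - f w"
  by (simp add: divdiff1_def)

text \<open>At \<open>z = w\<close> continuity is exactly differentiability of \<open>f\<close> at
  \<open>w\<close>; elsewhere the quotient is continuous. It makes \<open>tendsto_fun_calc\<close>
  applicable to the symbol with its second argument frozen at an eigenvalue.\<close>

lemma continuous_on_divdiff1:
  assumes f: "\<And>z. z \<in> unit_circle \<Longrightarrow> f field_differentiable (at z within unit_circle)"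
    and "w \<in> unit_circle"
  shows "continuous_on unit_circle (\<lambda>z. divdiff1 f z w)"
  unfolding continuous_on_def
proof
  fix z assume z: "z \<in> unit_circle"
  let ?F = "at z within unit_circle"
  show "((\<lambda>z. divdiff1 f z w) \<longlongrightarrow> divdiff1 f z w) ?F"
  proof (cases "z = w")
    case True
    have "((\<lambda>y. (f y - f z) / (y - z)) \<longlongrightarrow> circle_deriv f z) ?F"
      using circle_deriv_works[OF z f[OF z]] by (simp add: has_field_derivative_iff)
    moreover have "\<forall>\<^sub>F y in ?F. (f y - f z) / (y - z) = divdiff1 f y w"
      by (auto simp: eventually_at_filter divdiff1_def True)
    ultimately have "((\<lambda>y. divdiff1 f y w) \<longlongrightarrow> circle_deriv f z) ?F"
      by (rule Lim_transform_eventually)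
    then show ?thesis by (simp add: divdiff1_def True)
  next
    case False
    have "(f \<longlongrightarrow> f z) ?F"
      using field_differentiable_imp_continuous_at[OF f[OF z]] by (simp add: continuous_within)
    then have "((\<lambda>y. (f y - f w) / (y - w)) \<longlongrightarrow> (f z - f w) / (z - w)) ?F"
      by (intro tendsto_intros) (use False in auto)
    moreover have "\<forall>\<^sub>F y in ?F. (f y - f w) / (y - w) = divdiff1 f y w"
    proof -
      have "\<forall>\<^sub>F y in ?F. y \<noteq> w"
        by (rule tendsto_imp_eventually_ne[OF tendsto_ident_at False])
      then show ?thesis by eventually_elim (simp add: divdiff1_def)
    qed
    ultimately have "((\<lambda>y. divdiff1 f y w) \<longlongrightarrow> (f z - f w) / (z - w)) ?F"
      by (rule Lim_transform_eventually)
    then show ?thesis using False by (simp add: divdiff1_def)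
  qed
qed

lemma circle_deriv_divdiff1:
  assumes f: "f field_differentiable (at a within unit_circle)"
    and "a \<in> unit_circle" and "a \<noteq> b"
  shows "circle_deriv (\<lambda>z. divdiff1 f z b) a * (a - b) = circle_deriv f a - divdiff1 f a b"
proof -
  let ?D = "(circle_deriv f a * (a - b) - (f a - f b)) / ((a - b) * (a - b))"
  have "((\<lambda>z. (f z - f b) / (z - b)) has_field_derivative ?D) (at a within unit_circle)"
    using circle_deriv_works[OF \<open>a \<in> unit_circle\<close> f] \<open>a \<noteq> b\<close>
    by (auto intro!: derivative_eq_intros)
  \<comment> \<open>Within distance \<open>dist a b\<close> of \<open>a\<close> the point
    \<open>b\<close> is not met, so the divided difference is the plain quotient there.\<close>
  then have "((\<lambda>z. divdiff1 f z b) has_field_derivative ?D) (at a within unit_circle)"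
    by (rule has_field_derivative_transform_within[where d="dist a b"])
       (use assms in \<open>auto simp: divdiff1_def dist_commute\<close>)
  then have "circle_deriv (\<lambda>z. divdiff1 f z b) a = ?D"
    by (rule circle_deriv_eqI[OF \<open>a \<in> unit_circle\<close>])
  moreover have "(D * d - F) / (d * d) * d = D - F / d" if "d \<noteq> 0" for D d F :: complex
    using that by (simp add: field_simps)
  ultimately show ?thesis
    using \<open>a \<noteq> b\<close> by (simp add: divdiff1_def)
qed

lemma divdiff1_commute: "divdiff1 f a b = divdiff1 f b a"
  by (simp add: divdiff1_def) (metis minus_diff_eq minus_divide_divide)

text \<open>The definition of \<open>divdiff2\<close> divides by the difference of the outer arguments; the
  operator identity needs the symmetric form in which that of the first two is factored out.\<close>

lemma divdiff2_mult:
  assumes "f field_differentiable (at a within unit_circle)" and "a \<in> unit_circle"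
  shows "divdiff2 f a b c * (a - b) = divdiff1 f a c - divdiff1 f b c"
proof -
  consider "a = b" | "a \<noteq> b" "a = c" | "a \<noteq> c" by blast
  then show ?thesis
  proof cases
    case 1
    then show ?thesis by simp
  next
    case 2
    \<comment> \<open>Equal outer arguments: \<open>divdiff2\<close> is the derivative of a divided
      difference, and the quotient rule already carries the factor \<open>a - b\<close>.\<close>
    then show ?thesis
      using circle_deriv_divdiff1[OF assms \<open>a \<noteq> b\<close>] divdiff1_commute[of f a b]
      by (simp add: divdiff2_def) (simp add: divdiff1_def)
  next
    case 3
    let ?B = "divdiff1 f b c"
    \<comment> \<open>Both sides of the cleared equation are the error at \<open>a\<close> of the
      secant (or tangent, if \<open>b = c\<close>) with slope \<open>?B\<close> through the points
      at \<open>b\<close> and \<open>c\<close>. \<open>divdiff1_mult\<close> holds for coinciding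
      arguments as well, so no further cases arise.\<close>
    have "(divdiff1 f a b - ?B) * (a - b) = (f a - f b) - ?B * (a - b)"
      by (simp add: left_diff_distrib divdiff1_mult)
    also have "\<dots> = (f a - f c) - ?B * (a - c)"
      using divdiff1_mult[of f b c] by (simp add: algebra_simps)
    also have "\<dots> = (divdiff1 f a c - ?B) * (a - c)"
      by (simp add: left_diff_distrib divdiff1_mult)
    finally show ?thesis
      using 3 by (simp add: divdiff2_def divide_simps)
  qed
qed

section \<open>Continuity and differentiability of the functional calculus\<close>

text \<open>The identity, resolved into the projections of the other operator, is inserted on the
  right of \<open>fun_calc g V\<close> and on the left of \<open>fun_calc g U\<close>.\<close>

lemma fun_calc_diff_sum:
  assumes V: "eigenbasis V b z" and U: "eigenbasis U c w"
  shows "fun_calc g V - fun_calc g U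
    = (\<Sum>i\<in>UNIV. \<Sum>k\<in>UNIV. (g (z i) - g (w k)) *\<^sub>C (rank_one_proj (b i) ** rank_one_proj (c k)))"
proof -
  let ?P = "\<lambda>i. rank_one_proj (b i)" and ?Q = "\<lambda>k. rank_one_proj (c k)"
  have b: "orthonormal_basis b" and c: "orthonormal_basis c"
    using assms by (simp_all add: eigenbasis_def)
  have "(\<Sum>i\<in>UNIV. \<Sum>k\<in>UNIV. (g (z i) - g (w k)) *\<^sub>C (?P i ** ?Q k))
      = (\<Sum>i\<in>UNIV. \<Sum>k\<in>UNIV. g (z i) *\<^sub>C (?P i ** ?Q k))
        - (\<Sum>k\<in>UNIV. \<Sum>i\<in>UNIV. g (w k) *\<^sub>C (?P i ** ?Q k))"
    by (subst (3) sum.swap) (simp add: cscale_diff_left sum_subtractf)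
  also have "(\<Sum>i\<in>UNIV. \<Sum>k\<in>UNIV. g (z i) *\<^sub>C (?P i ** ?Q k)) = (\<Sum>i\<in>UNIV. g (z i) *\<^sub>C ?P i)"
    by (simp add: cscale_sum_right[symmetric] matrix_sum_right[symmetric] sum_orthonormal_proj[OF c])
  also have "(\<Sum>k\<in>UNIV. \<Sum>i\<in>UNIV. g (w k) *\<^sub>C (?P i ** ?Q k)) = (\<Sum>k\<in>UNIV. g (w k) *\<^sub>C ?Q k)"
    by (simp add: cscale_sum_right[symmetric] matrix_sum_left[symmetric] sum_orthonormal_proj[OF b])
  finally show ?thesis
    by (simp add: fun_calc_eq[OF V] fun_calc_eq[OF U])
qed

lemma norm_rank_one_proj:
  assumes "cinner v v = 1"
  shows "norm (rank_one_proj v) = 1"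
proof -
  have "of_real (\<Sum>i\<in>UNIV. (norm (v $ i))\<^sup>2) = (of_real 1 :: complex)"
    using assms unfolding cinner_self by simp
  then have v: "norm v = 1"
    unfolding of_real_eq_iff by (simp add: norm_vec_def L2_set_def)
  have "norm (rank_one_proj v $ i) = norm (v $ i)" for i
    using v by (simp add: norm_vec_def rank_one_proj_def norm_mult L2_set_right_distrib[symmetric])
  then have "norm (rank_one_proj v) = norm v"
    by (simp add: norm_vec_def)
  then show ?thesis using v by simp
qed

text \<open>Uniform continuity handles nearby points; points at distance at least \<open>d\<close>
  are handled by boundedness, since \<open>2 * M\<close> is at most \<open>2 * M / d\<close> times
  their distance. A bound affine in the distance is what can be multiplied by the norm of a product
  of projections.\<close>

lemma circle_modulus:
  fixes g :: "complex \<Rightarrow> complex"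
  assumes g: "continuous_on unit_circle g" and "e > 0"
  obtains L where "L \<ge> 0"
    "\<And>z w. z \<in> unit_circle \<Longrightarrow> w \<in> unit_circle \<Longrightarrow> norm (g z - g w) \<le> e + L * norm (z - w)"
proof -
  obtain M where M: "\<And>z. z \<in> unit_circle \<Longrightarrow> norm (g z) \<le> M"
    using compact_imp_bounded[OF compact_continuous_image[OF g compact_sphere]]
    unfolding bounded_iff by blast
  have "M \<ge> 0"
    using M[of 1] norm_ge_zero[of "g 1"] by (simp del: norm_ge_zero)
  obtain d where "d > 0" and d: "\<And>z w. z \<in> unit_circle \<Longrightarrow> w \<in> unit_circle \<Longrightarrow> dist w z < d \<Longrightarrow>
      dist (g w) (g z) < e"
    using compact_uniformly_continuous[OF g compact_sphere] \<open>e > 0\<close>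
    unfolding uniformly_continuous_on_def by metis
  show thesis
  proof (rule that[of "2 * M / d"])
    show "2 * M / d \<ge> 0" using \<open>M \<ge> 0\<close> \<open>d > 0\<close> by simp
    fix z w :: complex assume zw: "z \<in> unit_circle" "w \<in> unit_circle"
    show "norm (g z - g w) \<le> e + 2 * M / d * norm (z - w)"
    proof (cases "norm (z - w) < d")
      case True
      then have "norm (g z - g w) < e" using d[of w z] zw by (simp add: dist_norm)
      moreover have "0 \<le> 2 * M / d * norm (z - w)" using \<open>M \<ge> 0\<close> \<open>d > 0\<close> by simp
      ultimately show ?thesis by linarith
    next
      case False
      have "norm (g z - g w) \<le> 2 * M"
        using norm_triangle_ineq4[of "g z" "g w"] M[OF zw(1)] M[OF zw(2)] by linarith
      also have "\<dots> = 2 * M / d * d" using \<open>d > 0\<close> by simp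
      also have "\<dots> \<le> 2 * M / d * norm (z - w)"
        using False \<open>M \<ge> 0\<close> \<open>d > 0\<close> by (intro mult_left_mono) auto
      finally show ?thesis using \<open>e > 0\<close> by linarith
    qed
  qed
qed

text \<open>Where \<open>P\<^sub>i Q\<^sub>k\<close> does not vanish, \<open>z\<^sub>i - w\<^sub>k\<close> is small when \<open>V - U\<close> is, because
  \<open>(z\<^sub>i - w\<^sub>k) P\<^sub>i Q\<^sub>k = P\<^sub>i (V - U) Q\<^sub>k\<close>; so no convergence of eigenvectors is needed.\<close>

lemma fun_calc_diff_bound:
  assumes g: "continuous_on unit_circle g" and "e > 0"
  obtains L where "\<And>V U :: complex ^ 'n ^ 'n. unitary_mat V \<Longrightarrow> unitary_mat U \<Longrightarrow>
    norm (fun_calc g V - fun_calc g U) \<le> e + L * norm (V - U)"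
proof -
  obtain K where "K > 0"
      and K: "\<And>(A :: complex ^ 'n ^ 'n) (B :: complex ^ 'n ^ 'n).
        norm (A ** B) \<le> norm A * norm B * K"
    using bounded_bilinear.pos_bounded[OF bounded_bilinear_cmatrix_mult] by metis
  define N where "N = real CARD('n) * real CARD('n)"
  have "N > 0" by (simp add: N_def)
  \<comment> \<open>The double sum has \<open>N\<close> terms, and each product of projections has
    norm at most \<open>K\<close>; this share of \<open>e\<close> therefore adds up to
    \<open>e\<close>.\<close>
  have "e / (N * K) > 0" using \<open>e > 0\<close> \<open>K > 0\<close> \<open>N > 0\<close> by simp
  then obtain L where "L \<ge> 0" and L: "\<And>z w. z \<in> unit_circle \<Longrightarrow> w \<in> unit_circle \<Longrightarrow>
      norm (g z - g w) \<le> e / (N * K) + L * norm (z - w)"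
    using circle_modulus[OF g] by metis
  have "norm (fun_calc g V - fun_calc g U) \<le> e + N * L * K\<^sup>2 * norm (V - U)"
    if V: "unitary_mat V" and U: "unitary_mat U" for V U :: "complex ^ 'n ^ 'n"
  proof -
    obtain b z where b: "eigenbasis V b z" using unitary_eigenbasis_exists[OF V] by blast
    obtain c w where c: "eigenbasis U c w" using unitary_eigenbasis_exists[OF U] by blast
    let ?P = "\<lambda>i. rank_one_proj (b i)" and ?Q = "\<lambda>k. rank_one_proj (c k)"
    have P: "norm (?P i) = 1" for i
      using b by (simp add: norm_rank_one_proj eigenbasis_def orthonormal_basis_def)
    have Q: "norm (?Q i) = 1" for i
      using c by (simp add: norm_rank_one_proj eigenbasis_def orthonormal_basis_def)
    have "norm ((g (z i) - g (w k)) *\<^sub>C (?P i ** ?Q k)) \<le> e / N + L * (K\<^sup>2 * norm (V - U))" for i k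
    proof -
      have PQ: "norm (?P i ** ?Q k) \<le> K"
        using K[of "?P i" "?Q k"] by (simp add: P Q)
      have "norm (?P i ** (V - U) ** ?Q k) \<le> norm (?P i ** (V - U)) * norm (?Q k) * K"
        by (rule K)
      also have "\<dots> \<le> norm (V - U) * K * K"
        using mult_right_mono[OF K[of "?P i" "V - U"], of K] \<open>K > 0\<close> by (simp add: P Q)
      finally have PXQ: "norm (z i - w k) * norm (?P i ** ?Q k) \<le> K\<^sup>2 * norm (V - U)"
        unfolding proj_mult_diff_mult_proj[OF b c] norm_cscale
        by (simp add: power2_eq_square mult_ac)
      have "norm ((g (z i) - g (w k)) *\<^sub>C (?P i ** ?Q k))
          \<le> (e / (N * K) + L * norm (z i - w k)) * norm (?P i ** ?Q k)"
        unfolding norm_cscale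
        using L[OF unitary_eigenvalue[OF V b] unitary_eigenvalue[OF U c]]
        by (rule mult_right_mono) simp
      also have "\<dots> = e / (N * K) * norm (?P i ** ?Q k)
          + L * (norm (z i - w k) * norm (?P i ** ?Q k))"
        by (simp add: distrib_right mult.assoc)
      also have "\<dots> \<le> e / (N * K) * K + L * (K\<^sup>2 * norm (V - U))"
        using PQ PXQ \<open>L \<ge> 0\<close> \<open>e / (N * K) > 0\<close>
        by (intro add_mono mult_left_mono) auto
      also have "e / (N * K) * K = e / N" using \<open>K > 0\<close> by simp
      finally show ?thesis .
    qed
    then have "norm (fun_calc g V - fun_calc g U)
        \<le> (\<Sum>i\<in>(UNIV :: 'n set). \<Sum>k\<in>(UNIV :: 'n set). e / N + L * (K\<^sup>2 * norm (V - U)))"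
      unfolding fun_calc_diff_sum[OF b c] by (intro sum_norm_le)
    also have "\<dots> = N * (e / N + L * (K\<^sup>2 * norm (V - U)))"
      by (simp add: N_def)
    also have "\<dots> = e + N * L * K\<^sup>2 * norm (V - U)"
      using \<open>N > 0\<close> by (simp add: distrib_left mult.assoc)
    finally show ?thesis .
  qed
  then show thesis by (rule that)
qed

lemma tendsto_fun_calc:
  fixes V :: "'a \<Rightarrow> complex ^ 'n ^ 'n"
  assumes g: "continuous_on unit_circle g" and U: "unitary_mat U" and V: "\<And>t. unitary_mat (V t)"
    and lim: "(V \<longlongrightarrow> U) F"
  shows "((\<lambda>t. fun_calc g (V t)) \<longlongrightarrow> fun_calc g U) F"
proof (rule tendstoI)
  fix e :: real assume "e > 0"
  then have "e / 2 > 0" by simp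
  then obtain L where L: "\<And>t. norm (fun_calc g (V t) - fun_calc g U) \<le> e / 2 + L * norm (V t - U)"
    using fun_calc_diff_bound[OF g] U V by metis
  have "((\<lambda>t. e / 2 + L * norm (V t - U)) \<longlongrightarrow> e / 2 + L * norm (U - U)) F"
    by (intro tendsto_intros lim)
  then have "\<forall>\<^sub>F t in F. e / 2 + L * norm (V t - U) < e"
    by (rule order_tendstoD) (use \<open>e > 0\<close> in simp)
  then show "\<forall>\<^sub>F t in F. dist (fun_calc g (V t)) (fun_calc g U) < e"
    by eventually_elim (use L in \<open>auto simp: dist_norm intro: le_less_trans\<close>)
qed

section \<open>Operator integrals of divided differences, and the derivative along a curve of
  unitaries\<close>

lemma fun_calc_diff:
  assumes V: "unitary_mat V" and U: "unitary_mat U"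
  shows "fun_calc f V - fun_calc f U = double_op_integral (divdiff1 f) V U (V - U)"
proof -
  obtain b z where b: "eigenbasis V b z" using unitary_eigenbasis_exists[OF V] by blast
  obtain c w where c: "eigenbasis U c w" using unitary_eigenbasis_exists[OF U] by blast
  show ?thesis
    by (simp add: fun_calc_diff_sum[OF b c] double_op_integral_eq[OF b c]
        proj_mult_diff_mult_proj[OF b c] divdiff1_mult)
qed

lemma double_op_integral_diff:
  assumes "unitary_mat V" and "unitary_mat U"
  shows "double_op_integral \<phi> V U (X - Y) = double_op_integral \<phi> V U X - double_op_integral \<phi> V U Y"
proof -
  obtain b z where b: "eigenbasis V b z" using unitary_eigenbasis_exists[OF assms(1)] by blast
  obtain c w where c: "eigenbasis U c w" using unitary_eigenbasis_exists[OF assms(2)] by blast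
  show ?thesis
    by (simp add: double_op_integral_eq[OF b c] matrix_diff_left matrix_diff_right
        cscale_diff_right sum_subtractf)
qed

text \<open>Grouping by the eigenvalues of \<open>U\<close> leaves \<open>V\<close> only inside
  functional calculi, so that continuity in \<open>V\<close> can be applied without following its
  eigenvectors.\<close>

lemma double_op_integral_eq_fun_calc:
  assumes V: "unitary_mat V" and c: "eigenbasis U c w"
  shows "double_op_integral \<phi> V U X
    = (\<Sum>k\<in>UNIV. fun_calc (\<lambda>z. \<phi> z (w k)) V ** X ** rank_one_proj (c k))"
proof -
  obtain b z where b: "eigenbasis V b z" using unitary_eigenbasis_exists[OF V] by blast
  show ?thesis
    unfolding double_op_integral_eq[OF b c] fun_calc_eq[OF b]
    by (subst sum.swap) (simp add: matrix_sum_left)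
qed

lemma has_vector_derivative_iff_quotient:
  fixes f :: "real \<Rightarrow> 'a :: real_normed_vector"
  shows "(f has_vector_derivative D) (at x) \<longleftrightarrow> ((\<lambda>y. (f y - f x) /\<^sub>R (y - x)) \<longlongrightarrow> D) (at x)"
proof -
  have "norm (f y - f x - (y - x) *\<^sub>R D) / norm (y - x) = norm ((f y - f x) /\<^sub>R (y - x) - D)"
    if "y \<noteq> x" for y
  proof -
    have "(f y - f x) /\<^sub>R (y - x) - D = (f y - f x - (y - x) *\<^sub>R D) /\<^sub>R (y - x)"
      using that by (simp add: scaleR_diff_right)
    then show ?thesis by (simp add: divide_inverse mult.commute)
  qed
  then have "((\<lambda>y. norm (f y - f x - (y - x) *\<^sub>R D) / norm (y - x)) \<longlongrightarrow> 0) (at x) \<longleftrightarrow>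
      ((\<lambda>y. norm ((f y - f x) /\<^sub>R (y - x) - D)) \<longlongrightarrow> 0) (at x)"
    by (intro tendsto_cong) (auto simp: eventually_at_filter)
  then show ?thesis
    by (simp add: has_vector_derivative_def has_derivative_iff_norm bounded_linear_scaleR_left
        tendsto_norm_zero_iff Lim_null[symmetric])
qed

text \<open>An eigenbasis of \<open>V s\<close> is fixed once; in the difference quotient every
  factor depending on \<open>t\<close> then has a limit.\<close>

lemma fun_calc_has_vector_derivative:
  fixes V :: "real \<Rightarrow> complex ^ 'n ^ 'n"
  assumes f: "\<And>z. z \<in> unit_circle \<Longrightarrow> f field_differentiable (at z within unit_circle)"
    and V: "\<And>t. unitary_mat (V t)" and D: "(V has_vector_derivative D) (at s)"
  shows "((\<lambda>t. fun_calc f (V t)) has_vector_derivative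
    double_op_integral (divdiff1 f) (V s) (V s) D) (at s)"
proof -
  obtain c w where c: "eigenbasis (V s) c w" using unitary_eigenbasis_exists[OF V] by blast
  have lim: "(V \<longlongrightarrow> V s) (at s)"
    using has_vector_derivative_continuous[OF D] by (simp add: continuous_at)
  \<comment> \<open>This holds for \<open>t = s\<close> too: both sides are \<open>0\<close> because
    division by zero gives \<open>0\<close>.\<close>
  have "(fun_calc f (V t) - fun_calc f (V s)) /\<^sub>R (t - s)
      = (\<Sum>k\<in>UNIV. fun_calc (\<lambda>z. divdiff1 f z (w k)) (V t)
          ** ((V t - V s) /\<^sub>R (t - s)) ** rank_one_proj (c k))" for t
    by (simp add: fun_calc_diff[OF V V] double_op_integral_eq_fun_calc[OF V c] scaleR_sum_right
        bounded_bilinear.scaleR_right[OF bounded_bilinear_cmatrix_mult]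
        bounded_bilinear.scaleR_left[OF bounded_bilinear_cmatrix_mult])
  moreover have "((\<lambda>t. \<Sum>k\<in>UNIV. fun_calc (\<lambda>z. divdiff1 f z (w k)) (V t)
          ** ((V t - V s) /\<^sub>R (t - s)) ** rank_one_proj (c k))
      \<longlongrightarrow> (\<Sum>k\<in>UNIV. fun_calc (\<lambda>z. divdiff1 f z (w k)) (V s) ** D ** rank_one_proj (c k))) (at s)"
    using D
    by (intro tendsto_sum bounded_bilinear.tendsto[OF bounded_bilinear_cmatrix_mult]
        tendsto_fun_calc V lim tendsto_const continuous_on_divdiff1 f unitary_eigenvalue[OF V c])
       (simp_all add: has_vector_derivative_iff_quotient)
  ultimately show ?thesis
    by (simp add: has_vector_derivative_iff_quotient double_op_integral_eq_fun_calc[OF V c])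
qed

lemma triple_op_integral_divdiff2:
  assumes f: "\<And>z. z \<in> unit_circle \<Longrightarrow> f field_differentiable (at z within unit_circle)"
    and V: "unitary_mat V" and U: "unitary_mat U"
  shows "triple_op_integral (divdiff2 f) V U U (V - U) Y
    = double_op_integral (divdiff1 f) V U Y - double_op_integral (divdiff1 f) U U Y"
proof -
  obtain b z where b: "eigenbasis V b z" using unitary_eigenbasis_exists[OF V] by blast
  obtain c w where c: "eigenbasis U c w" using unitary_eigenbasis_exists[OF U] by blast
  let ?P = "\<lambda>i. rank_one_proj (b i)" and ?Q = "\<lambda>k. rank_one_proj (c k)"
  have dd: "divdiff2 f (z i) y x * (z i - y) = divdiff1 f (z i) x - divdiff1 f y x" for i x y
    by (rule divdiff2_mult[OF f]) (rule unitary_eigenvalue[OF V b])+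
  have "triple_op_integral (divdiff2 f) V U U (V - U) Y
      = (\<Sum>j\<in>UNIV. \<Sum>i\<in>UNIV. \<Sum>k\<in>UNIV. (divdiff1 f (z i) (w j) - divdiff1 f (w k) (w j)) *\<^sub>C
          (?P i ** ?Q k ** Y ** ?Q j))"
    unfolding triple_op_integral_eq[OF b c c]
    by (rule trans[OF sum.swap]) (simp add: proj_mult_diff_mult_proj[OF b c] dd)
  \<comment> \<open>For fixed \<open>j\<close> the inner sums are \<open>fun_calc_diff_sum\<close>
    for the symbol \<open>divdiff1 f x (w j)\<close> in the variable \<open>x\<close>.\<close>
  also have "\<dots> = (\<Sum>j\<in>UNIV. (fun_calc (\<lambda>x. divdiff1 f x (w j)) V
      - fun_calc (\<lambda>x. divdiff1 f x (w j)) U) ** Y ** ?Q j)"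
    by (simp add: fun_calc_diff_sum[OF b c] matrix_sum_left)
  also have "\<dots> = double_op_integral (divdiff1 f) V U Y - double_op_integral (divdiff1 f) U U Y"
    by (simp add: double_op_integral_eq_fun_calc[OF V c] double_op_integral_eq_fun_calc[OF U c]
        matrix_diff_left sum_subtractf)
  finally show ?thesis .
qed

section \<open>The second-order Taylor remainder\<close>

theorem theorem6:
  fixes Z U :: "complex ^ 'n ^ 'n"
    and f :: "complex \<Rightarrow> complex"
  assumes "self_adjoint_mat Z"
    and "unitary_mat U"
    and "C_circle 2 f"
  shows "(\<lambda>t::real. fun_calc f (mat_exp ((\<i> * of_real t) *\<^sub>C Z) ** U)) differentiable (at 0) \<and>
    fun_calc f (mat_exp (\<i> *\<^sub>C Z) ** U) - fun_calc f U
      - vector_derivative (\<lambda>t::real. fun_calc f (mat_exp ((\<i> * of_real t) *\<^sub>C Z) ** U)) (at 0)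
    = triple_op_integral (divdiff2 f) (mat_exp (\<i> *\<^sub>C Z) ** U) U U
        (mat_exp (\<i> *\<^sub>C Z) ** U - U) (\<i> *\<^sub>C Z ** U)
      + double_op_integral (divdiff1 f) (mat_exp (\<i> *\<^sub>C Z) ** U) U
        (mat_exp (\<i> *\<^sub>C Z) ** U - U - \<i> *\<^sub>C Z ** U)"
proof -
  have f: "f field_differentiable (at z within unit_circle)" if "z \<in> unit_circle" for z
    using assms(3) that by (simp add: numeral_2_eq_2)
  define V where "V t = mat_exp ((\<i> * of_real t) *\<^sub>C Z) ** U" for t :: real
  have V: "unitary_mat (V t)" for t
    unfolding V_def by (intro unitary_mult unitary_mat_exp assms)
  have V1: "mat_exp (\<i> *\<^sub>C Z) ** U = V 1" by (simp add: V_def)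
  \<comment> \<open>At \<open>t = 0\<close> every coefficient \<open>cis (t * \<zeta> i)\<close> is
    \<open>1\<close>, and the projections sum to the identity.\<close>
  have V0: "V 0 = U"
  proof -
    obtain b \<zeta> where b: "orthonormal_basis b"
        and e: "\<forall>t. mat_exp ((\<i> * of_real t) *\<^sub>C Z) = (\<Sum>i\<in>UNIV. cis (t * \<zeta> i) *\<^sub>C rank_one_proj (b i))"
      using mat_exp_self_adjoint[OF assms(1)] by blast
    show ?thesis
      unfolding V_def e[rule_format] by (simp add: sum_orthonormal_proj[OF b])
  qed
  have "(V has_vector_derivative \<i> *\<^sub>C Z ** U) (at 0)"
    unfolding V_def
    by (rule bounded_linear.has_vector_derivative[OF
          bounded_bilinear.bounded_linear_left[OF bounded_bilinear_cmatrix_mult]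
          mat_exp_has_vector_derivative[OF assms(1)]])
  from fun_calc_has_vector_derivative[OF f V this]
  have D: "((\<lambda>t. fun_calc f (V t)) has_vector_derivative
      double_op_integral (divdiff1 f) U U (\<i> *\<^sub>C Z ** U)) (at 0)"
    by (simp add: V0)
  have "(\<lambda>t. fun_calc f (V t)) differentiable (at 0)"
    using D by (rule differentiableI_vector)
  moreover have "triple_op_integral (divdiff2 f) (V 1) U U (V 1 - U) Y
      = double_op_integral (divdiff1 f) (V 1) U Y - double_op_integral (divdiff1 f) U U Y" for Y
    by (rule triple_op_integral_divdiff2[OF f V assms(2)])
  \<comment> \<open>The triple integral contributes the double integral over \<open>V 1, U\<close>
    at \<open>\<i> *\<^sub>C Z ** U\<close> minus the derivative; the former cancels against the
    subtracted part of the last double integral, leaving the double integral at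
    \<open>V 1 - U\<close>.\<close>
  then have "fun_calc f (V 1) - fun_calc f U - vector_derivative (\<lambda>t. fun_calc f (V t)) (at 0)
    = triple_op_integral (divdiff2 f) (V 1) U U (V 1 - U) (\<i> *\<^sub>C Z ** U)
      + double_op_integral (divdiff1 f) (V 1) U (V 1 - U - \<i> *\<^sub>C Z ** U)"
    by (simp add: vector_derivative_at[OF D] fun_calc_diff[OF V assms(2)]
        double_op_integral_diff[OF V assms(2)])
  ultimately show ?thesis
    unfolding V1 by (simp add: V_def)
qed

end
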